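(* Let $\mathbb{X}$ and $\mathbb{Y}$ be Banach spaces and let $\Theta:\mathbb{X}\rightrightarrows\mathbb{Y}$ be a closed convex process. If $$\exists\,\alpha>0,\ \exists\, u\in\mathbb{B}_{\mathbb{X}}\ \text{ such that }\ \Theta(u)\supseteq \operatorname{int}(\alpha\mathbb{B}_{\mathbb{Y}}),\qquad(\ast)$$ then $\Theta$ is set-covering on $\mathbb{X}$ with any constant $\tilde\alpha\in(0,\alpha)$. Conversely, if $\Theta$ is set-covering on $\mathbb{X}$ with a constant $\alpha>0$, then condition $(\ast)$ holds.
   Context: Conventions: all set-valued mappings considered have nonempty closed values at every point of their source space (in particular the domain of $\Theta$ is all of $\mathbb{X}$). $\mathbb{B}_{\mathbb{X}}$, $\mathbb{B}_{\mathbb{Y}}$ denote the closed unit balls centred at the null vector of $\mathbb{X}$ and $\mathbb{Y}$, and $\operatorname{int}$ the topological interior. A set-valued mapping $\Theta:\mathbb{X}\rightrightarrows\mathbb{Y}$ between normed spaces is a convex process if its graph is a convex cone in $\mathbb{X}\times\mathbb{Y}$ with apex at the null vector; equivalently: (i) $\mathbf{0}\in\Theta(\mathbf{0})$; (ii) $\Theta(\lambda x)=\lambda\Theta(x)$ for all $\lambda>0$, $x\in\mathbb{X}$; (iii) $\Theta(x_1)+\Theta(x_2)\subseteq\Theta(x_1+x_2)$ for all $x_1,x_2\in\mathbb{X}$. It is closed if its graph is closed. In a metric space, $\mathrm{B}(x,r)$ is the closed ball of center $x$ and radius $r$, $\operatorname{dist}(x,S)=\inf_{z\in S}d(z,x)$,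 and $\mathrm{B}(S,r)=\{x:\operatorname{dist}(x,S)\le r\}$ is the $r$-enlargement of a set $S$. A set-valued mapping $\Psi:X\rightrightarrows Y$ between metric spaces is set-covering on $X$ with constant $\alpha>0$ if for every $x\in X$ and every $r>0$ there exists $u\in \mathrm{B}(x,r)$ such that $\mathrm{B}(\Psi(x),\alpha r)\subseteq\Psi(u)$. *)

theory Defs
  imports "HOL-Analysis.Analysis"
begin

text \<open>A set-valued mapping from \<open>'a\<close> to \<open>'b\<close> is a function \<open>'a \<Rightarrow> 'b set\<close>.\<close>

definition gph :: "('a \<Rightarrow> 'b set) \<Rightarrow> ('a \<times> 'b) set"
  where "gph \<Theta> = {(x, y). y \<in> \<Theta> x}"

text \<open>The library predicate \<^const>\<open>convex_cone\<close> requires the set to be nonempty and stable under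
  multiplication by all \<open>c \<ge> 0\<close>, so the null vector, the apex, belongs to the graph.\<close>

definition convex_process :: "('a::real_normed_vector \<Rightarrow> 'b::real_normed_vector set) \<Rightarrow> bool"
  where "convex_process \<Theta> \<longleftrightarrow> convex_cone (gph \<Theta>)"

definition closed_convex_process :: "('a::real_normed_vector \<Rightarrow> 'b::real_normed_vector set) \<Rightarrow> bool"
  where "closed_convex_process \<Theta> \<longleftrightarrow> convex_process \<Theta> \<and> closed (gph \<Theta>)"

lemma convex_process_iff:
  "convex_process \<Theta> \<longleftrightarrow>
     0 \<in> \<Theta> 0 \<and>
     (\<forall>c>0. \<forall>x. \<Theta> (c *\<^sub>R x) = (\<lambda>y. c *\<^sub>R y) ` \<Theta> x) \<and>
     (\<forall>x1 x2. {y1 + y2 |y1 y2. y1 \<in> \<Theta> x1 \<and> y2 \<in> \<Theta> x2} \<subseteq> \<Theta> (x1 + x2))"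
  (is "_ \<longleftrightarrow> ?R")
proof
  assume "convex_process \<Theta>"
  then have cc: "convex_cone (gph \<Theta>)"
    by (simp add: convex_process_def)
  have zero: "0 \<in> \<Theta> 0"
    using cc by (auto simp: convex_cone_iff gph_def zero_prod_def)
  have add: "y1 + y2 \<in> \<Theta> (x1 + x2)" if "y1 \<in> \<Theta> x1" "y2 \<in> \<Theta> x2" for x1 x2 y1 y2
    using convex_cone_add[OF cc, of "(x1, y1)" "(x2, y2)"] that by (simp add: gph_def)
  have scale: "c *\<^sub>R y \<in> \<Theta> (c *\<^sub>R x)" if "0 < c" "y \<in> \<Theta> x" for c x y
    using convex_cone_scaleR[OF cc, of c "(x, y)"] that by (simp add: gph_def)
  have "\<Theta> (c *\<^sub>R x) = (\<lambda>y. c *\<^sub>R y) ` \<Theta> x" if "0 < c" for c x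
  proof
    show "(\<lambda>y. c *\<^sub>R y) ` \<Theta> x \<subseteq> \<Theta> (c *\<^sub>R x)"
      using scale that by blast
    show "\<Theta> (c *\<^sub>R x) \<subseteq> (\<lambda>y. c *\<^sub>R y) ` \<Theta> x"
    proof
      fix y assume "y \<in> \<Theta> (c *\<^sub>R x)"
      then have "inverse c *\<^sub>R y \<in> \<Theta> x"
        using scale[of "inverse c" y "c *\<^sub>R x"] that by simp
      then show "y \<in> (\<lambda>y. c *\<^sub>R y) ` \<Theta> x"
        using that by (intro image_eqI[of _ _ "inverse c *\<^sub>R y"]) auto
    qed
  qed
  then show ?R
    using zero add by blast
next
  assume R: ?R
  have "c *\<^sub>R p \<in> gph \<Theta>" if p: "p \<in> gph \<Theta>" and c: "0 \<le> c" for p c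
  proof (cases "c = 0")
    case True
    then show ?thesis using R by (auto simp: gph_def zero_prod_def)
  next
    case False
    then have "0 < c" using c by simp
    with R p show ?thesis by (auto simp: gph_def)
  qed
  moreover have "p + q \<in> gph \<Theta>" if "p \<in> gph \<Theta>" "q \<in> gph \<Theta>" for p q
  proof -
    have "snd p + snd q \<in> \<Theta> (fst p + fst q)"
      using R that unfolding gph_def case_prod_unfold mem_Collect_eq subset_iff by metis
    then show ?thesis by (simp add: gph_def case_prod_unfold)
  qed
  moreover have "0 \<in> gph \<Theta>"
    using R by (simp add: gph_def zero_prod_def)
  ultimately show "convex_process \<Theta>"
    unfolding convex_process_def convex_cone_iff by simp
qed

text \<open>Meant for nonempty \<open>S\<close> only: \<^term>\<open>infdist x {} = 0\<close> in the library.\<close>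

definition enlargement :: "'a::metric_space set \<Rightarrow> real \<Rightarrow> 'a set"
  where "enlargement S r = {x. infdist x S \<le> r}"

definition set_covering :: "('a::metric_space \<Rightarrow> 'b::metric_space set) \<Rightarrow> real \<Rightarrow> bool"
  where "set_covering \<Psi> \<alpha> \<longleftrightarrow>
    \<alpha> > 0 \<and> (\<forall>x. \<forall>r>0. \<exists>u\<in>cball x r. enlargement (\<Psi> x) (\<alpha> * r) \<subseteq> \<Psi> u)"

end

theory Submission
  imports Defs
begin

text \<open>Both directions use only the cone structure of the graph. If \<open>\<Theta> u\<close> contains the open ball of
  radius \<open>\<alpha>\<close> about the origin, then positive homogeneity makes \<open>\<Theta> (r u)\<close> contain the open ball of
  radius \<open>\<alpha> r\<close>, and superadditivity makes \<open>\<Theta> (x + r u)\<close> contain every point at distance less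
  than \<open>\<alpha> r\<close> from \<open>\<Theta> x\<close>. The gap between \<open>\<alpha>'\<close> and \<open>\<alpha>\<close> pays for the fact that the distance to
  \<open>\<Theta> x\<close> need not be attained. Conversely, covering at the origin with radius \<open>1\<close> gives
  a \<open>u\<close> in the unit ball whose image contains the closed \<open>\<alpha>\<close>-ball, because \<open>0 \<in> \<Theta> 0\<close>.\<close>

lemma convex_process_zero: "convex_process \<Theta> \<Longrightarrow> 0 \<in> \<Theta> 0"
  unfolding convex_process_iff by blast

lemma convex_process_scaleR:
  "convex_process \<Theta> \<Longrightarrow> 0 < c \<Longrightarrow> y \<in> \<Theta> x \<Longrightarrow> c *\<^sub>R y \<in> \<Theta> (c *\<^sub>R x)"
  unfolding convex_process_iff by blast

lemma convex_process_add:
  "convex_process \<Theta> \<Longrightarrow> y1 \<in> \<Theta> x1 \<Longrightarrow> y2 \<in> \<Theta> x2 \<Longrightarrow> y1 + y2 \<in> \<Theta> (x1 + x2)"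
  unfolding convex_process_iff by blast

lemma scaleR_unit_cball:
  fixes a :: real
  assumes "0 < a"
  shows "(\<lambda>y. a *\<^sub>R y) ` cball (0::'a::real_normed_vector) 1 = cball 0 a"
  using cball_scale[of a "0::'a" 1] assms by simp

lemma convex_process_set_covering_if_ball_subset:
  assumes cp: "convex_process \<Theta>" and ne: "\<And>x. \<Theta> x \<noteq> {}"
    and u: "u \<in> cball 0 1" "ball 0 a \<subseteq> \<Theta> u"
    and b: "0 < b" "b < a"
  shows "set_covering \<Theta> b"
  unfolding set_covering_def
proof (intro conjI allI impI)
  show "0 < b" by (rule b(1))
  fix x and r :: real
  assume r: "0 < r"
  have "enlargement (\<Theta> x) (b * r) \<subseteq> \<Theta> (x + r *\<^sub>R u)"
  proof
    fix y assume "y \<in> enlargement (\<Theta> x) (b * r)"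
    then have "infdist y (\<Theta> x) < a * r"
      using b r by (simp add: enlargement_def order_le_less_trans)
    then have "(INF z\<in>\<Theta> x. dist y z) < a * r"
      using ne by (simp add: infdist_notempty)
    then obtain z where z: "z \<in> \<Theta> x" "dist y z < a * r"
      using ne[of x] by (metis (no_types, lifting) bdd_below_image_dist cINF_less_iff)
    then have "inverse r * norm (y - z) < a"
      using r by (simp add: dist_norm field_simps)
    then have "inverse r *\<^sub>R (y - z) \<in> ball 0 a"
      using r by (simp del: scaleR_diff_right)
    then have "inverse r *\<^sub>R (y - z) \<in> \<Theta> u"
      using u(2) by blast
    from convex_process_scaleR[OF cp r this] r have "y - z \<in> \<Theta> (r *\<^sub>R u)"
      by simp
    from convex_process_add[OF cp z(1) this] show "y \<in> \<Theta> (x + r *\<^sub>R u)"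
      by simp
  qed
  moreover have "x + r *\<^sub>R u \<in> cball x r"
    using u(1) r by (simp add: dist_norm mult_left_le)
  ultimately show "\<exists>v\<in>cball x r. enlargement (\<Theta> x) (b * r) \<subseteq> \<Theta> v"
    by blast
qed

lemma convex_process_cball_subset_if_set_covering:
  assumes cp: "convex_process \<Theta>" and cov: "set_covering \<Theta> a"
  shows "\<exists>u\<in>cball 0 1. cball 0 a \<subseteq> \<Theta> u"
proof -
  obtain u where u: "u \<in> cball 0 1" "enlargement (\<Theta> 0) (a * 1) \<subseteq> \<Theta> u"
    using cov unfolding set_covering_def by (meson zero_less_one)
  have "cball 0 a \<subseteq> enlargement (\<Theta> 0) (a * 1)"
  proof
    fix y :: 'b assume "y \<in> cball 0 a"
    then show "y \<in> enlargement (\<Theta> 0) (a * 1)"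
      using infdist_le[OF convex_process_zero[OF cp], of y] by (simp add: enlargement_def)
  qed
  with u show ?thesis by blast
qed

theorem proposition2p6:
  fixes \<Theta> :: "'a::banach \<Rightarrow> 'b::banach set"
  assumes "\<And>x. \<Theta> x \<noteq> {}" and "\<And>x. closed (\<Theta> x)"
    and "closed_convex_process \<Theta>"
  shows "(\<forall>\<alpha>>0. (\<exists>u\<in>cball 0 1. interior ((\<lambda>y. \<alpha> *\<^sub>R y) ` cball 0 1) \<subseteq> \<Theta> u) \<longrightarrow>
            (\<forall>\<alpha>'\<in>{0<..<\<alpha>}. set_covering \<Theta> \<alpha>'))
       \<and> (\<forall>\<alpha>>0. set_covering \<Theta> \<alpha> \<longrightarrow>
            (\<exists>\<beta>>0. \<exists>u\<in>cball 0 1. interior ((\<lambda>y. \<beta> *\<^sub>R y) ` cball 0 1) \<subseteq> \<Theta> u))"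
proof (intro conjI allI impI ballI)
  have cp: "convex_process \<Theta>"
    using assms(3) by (simp add: closed_convex_process_def)
  fix a :: real
  assume a: "0 < a"
  {
    fix b
    assume "\<exists>u\<in>cball 0 1. interior ((\<lambda>y. a *\<^sub>R y) ` cball 0 1) \<subseteq> \<Theta> u" and b: "b \<in> {0<..<a}"
    then obtain u where u: "u \<in> cball 0 1" "interior (cball 0 a) \<subseteq> \<Theta> u"
      using a by (auto simp: scaleR_unit_cball)
    have "ball 0 a \<subseteq> interior (cball (0::'b) a)"
      by (simp add: interior_maximal ball_subset_cball)
    with u(2) have "ball 0 a \<subseteq> \<Theta> u"
      by blast
    with b show "set_covering \<Theta> b"
      using convex_process_set_covering_if_ball_subset[OF cp assms(1) u(1)] by auto
  next
    assume "set_covering \<Theta> a"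
    then obtain u where u: "u \<in> cball 0 1" "cball 0 a \<subseteq> \<Theta> u"
      using convex_process_cball_subset_if_set_covering[OF cp] by blast
    have "interior ((\<lambda>y. a *\<^sub>R y) ` cball 0 1) \<subseteq> \<Theta> u"
      using u(2) interior_subset scaleR_unit_cball[OF a] by (metis order_trans)
    with a u(1) show "\<exists>\<beta>>0. \<exists>u\<in>cball 0 1. interior ((\<lambda>y. \<beta> *\<^sub>R y) ` cball 0 1) \<subseteq> \<Theta> u"
      by blast
  }
qed

end
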